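(* Let $f:\mathbb{R}^n\to\mathbb{R}$, $h:\mathbb{R}^n\to\mathbb{R}^p$ and $g:\mathbb{R}^n\to\mathbb{R}^m$ be continuously differentiable, and consider the nonlinear program $\min_{x\in\mathbb{R}^n} f(x)$ subject to $h(x)=0$, $g(x)\le 0$, together with the SPPID dynamics (defined in the context) with gains $k_i^{eq}, k_i^{in}, k_p^{in}>0$ (and $k_p^{eq},k_d^{eq}\ge 0$). Then: (i) A point $(x^\star,\nu^\star,\xi^\star)\in\mathbb{R}^n\times\mathbb{R}^p\times\mathbb{R}^m$ is an equilibrium of the SPPID dynamics if and only if there exist multipliers $\lambda^\star\in\mathbb{R}^p$ and $\mu^\star\in\mathbb{R}^m_{\ge 0}$ such that $(x^\star,\lambda^\star,\mu^\star)$ satisfies the KKT conditions of the program, and $\lambda^\star=\nu^\star$, $\mu^\star=\xi^\star$. (ii) The SPPID dynamics are a preconditioned primal--dual gradient flow of the augmented Lagrangian $L_{aug}$ (defined in the context), namely they coincide with $$\dot x=-M(x)^{-1}\nabla_x L_{aug}(x,\nu,\xi),\qquad \dot\nu=k_i^{eq}\,\nabla_\nu L_{aug}(x,\nu,\xi),\qquad \dot\xi=k_i^{in}k_p^{in}\,\nabla_\xi L_{aug}(x,\nu,\xi).$$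
   Context: $\mathrm{ReLU}(y)=\max(y,0)$ componentwise; vector inequalities are entrywise; $J_h(x)\in\mathbb{R}^{p\times n}$ and $J_g(x)\in\mathbb{R}^{m\times n}$ are Jacobians; $\|\cdot\|$ is the Euclidean norm. Set $M(x):=I_n+k_d^{eq}J_h(x)^\top J_h(x)$. The SPPID dynamics with state $(x,\nu,\xi)\in\mathbb{R}^n\times\mathbb{R}^p\times\mathbb{R}^m$ are $$\dot x=-M(x)^{-1}\Big(\nabla f(x)+J_h(x)^\top(\nu+k_p^{eq}h(x))+J_g(x)^\top\mathrm{ReLU}(\xi+k_p^{in}g(x))\Big),$$ $$\dot\nu=k_i^{eq}h(x),\qquad \dot\xi=k_i^{in}\big(\mathrm{ReLU}(\xi+k_p^{in}g(x))-\xi\big).$$ KKT conditions for $(x^\star,\lambda^\star,\mu^\star)$: $\nabla f(x^\star)+J_h(x^\star)^\top\lambda^\star+J_g(x^\star)^\top\mu^\star=0$, $h(x^\star)=0$, $g(x^\star)\le 0$, $\mu^\star\ge 0$, and $\mu_i^\star g_i(x^\star)=0$ for all $i$. Augmented Lagrangian: $$L_{aug}(x,\nu,\xi)=f(x)+\nu^\top h(x)+\frac{k_p^{eq}}{2}\|h(x)\|^2+\frac{1}{2k_p^{in}}\sum_{i=1}^m\Big(\big[\mathrm{ReLU}(\xi_i+k_p^{in}g_i(x))\big]^2-\xi_i^2\Big).$$ Standing assumption of the problem setup: the program admits at least one optimal solution at which a constraint qualification holds, so that the set of KKT points is nonempty. *)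

theory Defs
  imports "HOL-Analysis.Analysis"
begin

definition C1 :: "('a::real_normed_vector \<Rightarrow> 'b::real_normed_vector) \<Rightarrow> bool" where
  "C1 F \<longleftrightarrow> (\<exists>F' :: 'a \<Rightarrow> 'a \<Rightarrow>\<^sub>L 'b.
     (\<forall>x. (F has_derivative blinfun_apply (F' x)) (at x)) \<and> continuous_on UNIV F')"

text \<open>The gradient is a meaningful value only where it exists; see \<open>grad_eqI\<close>.\<close>

definition grad :: "('a::real_inner \<Rightarrow> real) \<Rightarrow> 'a \<Rightarrow> 'a" where
  "grad F x = (THE D. GDERIV F x :> D)"

lemma grad_eqI:
  assumes "GDERIV F x :> D"
  shows "grad F x = D"
  unfolding grad_def
proof (rule the_equality[where P = "\<lambda>D. GDERIV F x :> D", OF assms])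
  fix D' assume "GDERIV F x :> D'"
  with assms have "(\<lambda>h. h \<bullet> D') = (\<lambda>h. h \<bullet> D)"
    unfolding gderiv_def by (rule has_derivative_unique[rotated])
  then have "h \<bullet> D' = h \<bullet> D" for h
    by (rule fun_cong)
  then show "D' = D"
    by (metis inner_commute vector_eq_rdot)
qed

definition relu :: "real ^ 'm \<Rightarrow> real ^ 'm" where
  "relu y = (\<chi> i. max (y $ i) 0)"

abbreviation Jac :: "(real ^ 'n \<Rightarrow> real ^ 'p) \<Rightarrow> real ^ 'n \<Rightarrow> real ^ 'n ^ 'p" where
  "Jac F x \<equiv> jacobian F (at x)"


definition feasible :: "(real ^ 'n \<Rightarrow> real ^ 'p) \<Rightarrow> (real ^ 'n \<Rightarrow> real ^ 'm) \<Rightarrow> real ^ 'n \<Rightarrow> bool" where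
  "feasible h g x \<longleftrightarrow> h x = 0 \<and> g x \<le> 0"

definition optimal ::
  "(real ^ 'n \<Rightarrow> real) \<Rightarrow> (real ^ 'n \<Rightarrow> real ^ 'p) \<Rightarrow> (real ^ 'n \<Rightarrow> real ^ 'm) \<Rightarrow> real ^ 'n \<Rightarrow> bool" where
  "optimal f h g x \<longleftrightarrow> feasible h g x \<and> (\<forall>y. feasible h g y \<longrightarrow> f x \<le> f y)"

definition KKT ::
  "(real ^ 'n \<Rightarrow> real) \<Rightarrow> (real ^ 'n \<Rightarrow> real ^ 'p) \<Rightarrow> (real ^ 'n \<Rightarrow> real ^ 'm) \<Rightarrow>
   real ^ 'n \<Rightarrow> real ^ 'p \<Rightarrow> real ^ 'm \<Rightarrow> bool" where
  "KKT f h g x lam \<mu> \<longleftrightarrow>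
     grad f x + transpose (Jac h x) *v lam + transpose (Jac g x) *v \<mu> = 0 \<and>
     h x = 0 \<and> g x \<le> 0 \<and> 0 \<le> \<mu> \<and> (\<forall>i. \<mu> $ i * g x $ i = 0)"

text \<open>
  No particular constraint qualification is singled out. This is what all of them (LICQ,
  MFCQ, Abadie, Guignard, ...) have in common: a condition on the constraints at \<open>x\<close> under
  which the KKT conditions are necessary for every objective with a local minimum at \<open>x\<close>.
\<close>

definition constraint_qualification ::
  "(real ^ 'n \<Rightarrow> real ^ 'p) \<Rightarrow> (real ^ 'n \<Rightarrow> real ^ 'm) \<Rightarrow> real ^ 'n \<Rightarrow> bool" where
  "constraint_qualification h g x \<longleftrightarrow>
     (\<forall>\<phi> :: real ^ 'n \<Rightarrow> real.
        C1 \<phi> \<and> (\<exists>e>0. \<forall>y\<in>ball x e. feasible h g y \<longrightarrow> \<phi> x \<le> \<phi> y)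
        \<longrightarrow> (\<exists>lam \<mu>. KKT \<phi> h g x lam \<mu>))"


definition M_mat :: "real \<Rightarrow> (real ^ 'n \<Rightarrow> real ^ 'p) \<Rightarrow> real ^ 'n \<Rightarrow> real ^ 'n ^ 'n" where
  "M_mat kd_eq h x = mat 1 + kd_eq *\<^sub>R (transpose (Jac h x) ** Jac h x)"

lemma invertible_M_mat:
  assumes "0 \<le> kd_eq"
  shows "invertible (M_mat kd_eq h x)"
proof -
  have "v = 0" if "M_mat kd_eq h x *v v = 0" for v
  proof -
    have Jt: "v \<bullet> (transpose (Jac h x) *v w) = (Jac h x *v v) \<bullet> w" for w
      by (metis dot_lmul_matrix inner_commute transpose_matrix_vector)
    have "0 = v \<bullet> (M_mat kd_eq h x *v v)"
      using that by simp
    also have "\<dots> = v \<bullet> (v + kd_eq *\<^sub>R (transpose (Jac h x) *v (Jac h x *v v)))"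
      by (simp only: M_mat_def matrix_vector_mult_add_rdistrib scaleR_matrix_vector_assoc
          matrix_vector_mul_assoc matrix_vector_mul_lid)
    also have "\<dots> = v \<bullet> v + kd_eq * ((Jac h x *v v) \<bullet> (Jac h x *v v))"
      by (simp only: inner_add_right inner_scaleR_right Jt)
    finally have "v \<bullet> v \<le> 0"
      using assms mult_nonneg_nonneg[OF assms inner_ge_zero] by (smt (verit))
    then show ?thesis
      by (metis antisym inner_eq_zero_iff inner_ge_zero)
  qed
  then show ?thesis
    using invertible_left_inverse matrix_left_invertible_ker by blast
qed

text \<open>A dynamical system is represented by its vector field on the state \<open>(x, \<nu>, \<xi>)\<close>.\<close>

definition sppid_field ::
  "(real ^ 'n \<Rightarrow> real) \<Rightarrow> (real ^ 'n \<Rightarrow> real ^ 'p) \<Rightarrow> (real ^ 'n \<Rightarrow> real ^ 'm) \<Rightarrow>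
   real \<Rightarrow> real \<Rightarrow> real \<Rightarrow> real \<Rightarrow> real \<Rightarrow>
   (real ^ 'n) \<times> (real ^ 'p) \<times> (real ^ 'm) \<Rightarrow> (real ^ 'n) \<times> (real ^ 'p) \<times> (real ^ 'm)" where
  "sppid_field f h g ki_eq kp_eq kd_eq ki_in kp_in = (\<lambda>(x, \<nu>, \<xi>).
     (- (matrix_inv (M_mat kd_eq h x) *v
           (grad f x + transpose (Jac h x) *v (\<nu> + kp_eq *\<^sub>R h x)
                     + transpose (Jac g x) *v relu (\<xi> + kp_in *\<^sub>R g x))),
      ki_eq *\<^sub>R h x,
      ki_in *\<^sub>R (relu (\<xi> + kp_in *\<^sub>R g x) - \<xi>)))"

definition equilibrium :: "('s::real_normed_vector \<Rightarrow> 's) \<Rightarrow> 's \<Rightarrow> bool" where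
  "equilibrium F z \<longleftrightarrow> F z = 0"

definition L_aug ::
  "(real ^ 'n \<Rightarrow> real) \<Rightarrow> (real ^ 'n \<Rightarrow> real ^ 'p) \<Rightarrow> (real ^ 'n \<Rightarrow> real ^ 'm) \<Rightarrow>
   real \<Rightarrow> real \<Rightarrow> real ^ 'n \<Rightarrow> real ^ 'p \<Rightarrow> real ^ 'm \<Rightarrow> real" where
  "L_aug f h g kp_eq kp_in x \<nu> \<xi> =
     f x + \<nu> \<bullet> h x + kp_eq / 2 * (norm (h x))\<^sup>2
     + 1 / (2 * kp_in) * (\<Sum>i\<in>UNIV. ((relu (\<xi> + kp_in *\<^sub>R g x) $ i)\<^sup>2 - (\<xi> $ i)\<^sup>2))"

end

theory Submission
  imports Defs
begin

text \<open>
  Although \<open>max t 0\<close> has a kink at \<open>0\<close>, its square is differentiable with derivative \<open>2 max t 0\<close>.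
  So the gradient of the augmented Lagrangian can be computed by the chain rule and matches the
  vector field. At an equilibrium the invertible preconditioner drops out, and
  \<open>\<xi> = relu (\<xi> + k g x)\<close> with \<open>k > 0\<close> encodes primal and dual feasibility together with
  complementary slackness.
\<close>

lemma differentiable_if_C1: "C1 F \<Longrightarrow> F differentiable (at x)"
  unfolding C1_def differentiable_def by blast

lemma differentiable_if_GDERIV: "GDERIV F x :> D \<Longrightarrow> F differentiable (at x)"
  unfolding gderiv_def differentiable_def by blast

text \<open>Riesz representation: the derivative is a linear functional, so it is the inner product
  with \<open>adjoint F' 1\<close>. This shows that the description behind \<open>grad\<close>
  denotes an actual gradient.\<close>

lemma GDERIV_grad:
  fixes F :: "'a::euclidean_space \<Rightarrow> real"
  assumes "F differentiable (at x)"
  shows "GDERIV F x :> grad F x"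
proof -
  obtain F' where F': "(F has_derivative F') (at x)"
    using assms unfolding differentiable_def by blast
  then have "F' = (\<lambda>d. d \<bullet> adjoint F' 1)"
    using adjoint_works[OF has_derivative_linear[OF F'], where y = 1] by simp
  with F' have "GDERIV F x :> adjoint F' 1"
    unfolding gderiv_def by simp
  then show ?thesis
    using grad_eqI by metis
qed

text \<open>Chain rule in gradient form. Moving the Jacobian to the other side of the inner product
  produces the transposes that appear in the vector field.\<close>

lemma GDERIV_compose:
  fixes F :: "real ^ 'n \<Rightarrow> real ^ 'm"
  assumes "GDERIV P (F x) :> D" and "F differentiable (at x)"
  shows "GDERIV (\<lambda>y. P (F y)) x :> transpose (Jac F x) *v D"
proof -
  have F': "(F has_derivative (\<lambda>d. Jac F x *v d)) (at x)"
    using assms(2) jacobian_works by blast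
  have "(Jac F x *v d) \<bullet> D = d \<bullet> (transpose (Jac F x) *v D)" for d
    by (metis dot_lmul_matrix inner_commute transpose_matrix_vector)
  with has_derivative_compose[OF F' assms(1)[unfolded gderiv_def]] show ?thesis
    unfolding gderiv_def by simp
qed

lemma DERIV_max_0_squared:
  fixes t :: real
  shows "((\<lambda>s. (max s 0)\<^sup>2) has_real_derivative 2 * max t 0) (at t)"
proof -
  consider "t > 0" | "t < 0" | "t = 0" by linarith
  then show ?thesis
  proof cases
    case 1
    have "((\<lambda>s. s\<^sup>2) has_real_derivative 2 * max t 0) (at t)"
      using 1 by (auto intro!: derivative_eq_intros)
    then show ?thesis
      by (rule has_field_derivative_transform_within_open[of _ _ _ "{0<..}"]) (use 1 in auto)
  next
    case 2
    have "((\<lambda>s. 0) has_real_derivative 2 * max t 0) (at t)"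
      using 2 by simp
    then show ?thesis
      by (rule has_field_derivative_transform_within_open[of _ _ _ "{..<0}"]) (use 2 in auto)
  next
    case 3
    have "((\<lambda>s. max s 0) \<longlongrightarrow> max 0 0) (at (0::real))"
      by (intro tendsto_intros)
    \<comment> \<open>The right side is the difference quotient at the kink. It equals
      \<open>s\<close> for positive \<open>s\<close> and 0 for negative \<open>s\<close>, so it
      tends to 0.\<close>
    moreover have "\<forall>\<^sub>F s in at (0::real). max s 0 = (max s 0)\<^sup>2 / s"
      by (auto simp: eventually_at_filter power2_eq_square max_def)
    ultimately have "((\<lambda>s. (max s 0)\<^sup>2 / s) \<longlongrightarrow> max 0 0) (at (0::real))"
      by (rule Lim_transform_eventually)
    then show ?thesis
      using 3 by (simp add: has_field_derivative_iff)
  qed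
qed

lemma GDERIV_sum_relu_squared:
  fixes y :: "real ^ 'm"
  shows "GDERIV (\<lambda>z. \<Sum>i\<in>UNIV. (relu z $ i)\<^sup>2) y :> 2 *\<^sub>R relu y"
proof -
  have "((\<lambda>z. (relu z $ i)\<^sup>2) has_derivative (\<lambda>d. (2 * max (y $ i) 0) * d $ i)) (at y)" for i
    unfolding relu_def vec_lambda_beta
    using has_derivative_compose[OF bounded_linear_imp_has_derivative[OF bounded_linear_vec_nth]
        DERIV_max_0_squared[unfolded has_field_derivative_def]] .
  then have "((\<lambda>z. \<Sum>i\<in>UNIV. (relu z $ i)\<^sup>2) has_derivative
      (\<lambda>d. \<Sum>i\<in>UNIV. (2 * max (y $ i) 0) * d $ i)) (at y)"
    by (intro has_derivative_sum)
  moreover have "(\<lambda>d. \<Sum>i\<in>UNIV. (2 * max (y $ i) 0) * d $ i) = (\<lambda>d. d \<bullet> (2 *\<^sub>R relu y))"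
    by (simp add: inner_vec_def relu_def mult_ac)
  ultimately show ?thesis
    unfolding gderiv_def by simp
qed

text \<open>Groups the terms into a function of \<open>x\<close>, one of \<open>h x\<close> and one
  of \<open>g x\<close>, so that the chain rule applies to each block, and separates the quadratic
  term in \<xi> from the squared relu.\<close>

lemma L_aug_eq:
  "L_aug f h g kp_eq kp_in x \<nu> \<xi> =
     f x + \<nu> \<bullet> h x + kp_eq / 2 * (h x \<bullet> h x)
     + (1 / (2 * kp_in) * (\<Sum>i\<in>UNIV. (relu (\<xi> + kp_in *\<^sub>R g x) $ i)\<^sup>2)
        - 1 / (2 * kp_in) * (\<xi> \<bullet> \<xi>))"
proof -
  have "(\<Sum>i\<in>UNIV. (\<xi> $ i)\<^sup>2) = \<xi> \<bullet> \<xi>"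
    by (simp add: inner_vec_def power2_eq_square)
  then show ?thesis
    by (simp add: L_aug_def power2_norm_eq_inner sum_subtractf right_diff_distrib)
qed

lemma GDERIV_L_aug_primal:
  fixes f :: "real ^ 'n \<Rightarrow> real" and h :: "real ^ 'n \<Rightarrow> real ^ 'p" and g :: "real ^ 'n \<Rightarrow> real ^ 'm"
  assumes f: "f differentiable (at x)" and h: "h differentiable (at x)"
    and g: "g differentiable (at x)" and "kp_in \<noteq> 0"
  shows "GDERIV (\<lambda>x'. L_aug f h g kp_eq kp_in x' \<nu> \<xi>) x :>
    grad f x + transpose (Jac h x) *v (\<nu> + kp_eq *\<^sub>R h x)
      + transpose (Jac g x) *v relu (\<xi> + kp_in *\<^sub>R g x)"
proof -
  have "GDERIV (\<lambda>w. \<nu> \<bullet> w + kp_eq / 2 * (w \<bullet> w)) (h x) :> \<nu> + kp_eq *\<^sub>R h x"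
    unfolding gderiv_def
    by (auto intro!: derivative_eq_intros simp: inner_commute inner_add_left algebra_simps)
  from GDERIV_compose[OF this h]
  have H: "GDERIV (\<lambda>x'. \<nu> \<bullet> h x' + kp_eq / 2 * (h x' \<bullet> h x')) x :>
      transpose (Jac h x) *v (\<nu> + kp_eq *\<^sub>R h x)" .
  have "((\<lambda>w. \<xi> + kp_in *\<^sub>R w) has_derivative (\<lambda>d. kp_in *\<^sub>R d)) (at (g x))"
    by (auto intro!: derivative_eq_intros)
  note has_derivative_compose[OF this GDERIV_sum_relu_squared[unfolded gderiv_def]]
  \<comment> \<open>The factor \<open>1 / (2 * kp_in)\<close> cancels the 2 from the square and the
    \<open>kp_in\<close> from the inner affine map. The term in \<open>\<xi> \<bullet> \<xi>\<close>
    is constant in \<open>w\<close>.\<close>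
  from has_derivative_diff[OF has_derivative_mult_right[OF this] has_derivative_const]
  have "GDERIV (\<lambda>w. 1 / (2 * kp_in) * (\<Sum>i\<in>UNIV. (relu (\<xi> + kp_in *\<^sub>R w) $ i)\<^sup>2)
      - 1 / (2 * kp_in) * (\<xi> \<bullet> \<xi>)) (g x) :> relu (\<xi> + kp_in *\<^sub>R g x)"
    unfolding gderiv_def by (rule has_derivative_eq_rhs) (use \<open>kp_in \<noteq> 0\<close> in auto)
  from GDERIV_compose[OF this g]
  have "GDERIV (\<lambda>x'. 1 / (2 * kp_in) * (\<Sum>i\<in>UNIV. (relu (\<xi> + kp_in *\<^sub>R g x') $ i)\<^sup>2)
      - 1 / (2 * kp_in) * (\<xi> \<bullet> \<xi>)) x :> transpose (Jac g x) *v relu (\<xi> + kp_in *\<^sub>R g x)" .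
  from GDERIV_add[OF GDERIV_add[OF GDERIV_grad[OF f] H] this] show ?thesis
    unfolding L_aug_eq by (simp only: add.assoc)
qed

lemma GDERIV_L_aug_eq_dual:
  "GDERIV (\<lambda>\<nu>'. L_aug f h g kp_eq kp_in x \<nu>' \<xi>) \<nu> :> h x"
  unfolding L_aug_def gderiv_def by (auto intro!: derivative_eq_intros)

text \<open>In contrast to the primal gradient, the inner map is now a translation and contributes
  no \<open>kp_in\<close>. Hence a factor \<open>1 / kp_in\<close> survives, which explains the gain
  \<open>ki_in * kp_in\<close> in the flow.\<close>

lemma GDERIV_L_aug_in_dual:
  assumes "kp_in \<noteq> 0"
  shows "GDERIV (\<lambda>\<xi>'. L_aug f h g kp_eq kp_in x \<nu> \<xi>') \<xi> :>
    (1 / kp_in) *\<^sub>R (relu (\<xi> + kp_in *\<^sub>R g x) - \<xi>)"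
proof -
  have "((\<lambda>w. w + kp_in *\<^sub>R g x) has_derivative (\<lambda>d. d)) (at \<xi>)"
    by (auto intro!: derivative_eq_intros)
  note has_derivative_compose[OF this GDERIV_sum_relu_squared[unfolded gderiv_def]]
  note P = has_derivative_mult_right[OF this, of "1 / (2 * kp_in)"]
  have "((\<lambda>w. 1 / (2 * kp_in) * (w \<bullet> w)) has_derivative (\<lambda>d. (d \<bullet> \<xi>) / kp_in)) (at \<xi>)"
    using assms by (auto intro!: derivative_eq_intros simp: inner_commute)
  note has_derivative_add[OF has_derivative_const has_derivative_diff[OF P this]]
  then show ?thesis
    unfolding L_aug_eq gderiv_def
    by (rule has_derivative_eq_rhs) (auto simp: inner_diff_right diff_divide_distrib)
qed

lemma relu_fixed_point_iff:
  fixes \<xi> y :: "real ^ 'm"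
  assumes "k > 0"
  shows "relu (\<xi> + k *\<^sub>R y) = \<xi> \<longleftrightarrow> y \<le> 0 \<and> 0 \<le> \<xi> \<and> (\<forall>i. \<xi> $ i * y $ i = 0)"
proof -
  \<comment> \<open>If \<open>a + k * b\<close> is nonnegative, the equation forces
    \<open>b = 0\<close>; otherwise it forces \<open>a = 0\<close> and \<open>b < 0\<close>. Both
    use \<open>k > 0\<close>.\<close>
  have "max (a + k * b) 0 = a \<longleftrightarrow> b \<le> 0 \<and> 0 \<le> a \<and> a * b = 0" for a b :: real
    using assms by (auto simp: max_def mult_le_0_iff zero_le_mult_iff)
  then show ?thesis
    by (auto simp: relu_def vec_eq_iff less_eq_vec_def)
qed

lemma matrix_inv_mult_eq_0_iff:
  fixes A :: "real ^ 'n ^ 'n"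
  assumes "invertible A"
  shows "matrix_inv A *v v = 0 \<longleftrightarrow> v = 0"
proof -
  have "A ** matrix_inv A = mat 1"
    \<comment> \<open>\<open>matrix_inv\<close> is a Hilbert choice, so its inverse property has to
      be extracted from invertibility.\<close>
    using someI_ex[OF assms[unfolded invertible_def]] unfolding matrix_inv_def by blast
  then show ?thesis
    by (metis matrix_vector_mul_assoc matrix_vector_mul_lid matrix_vector_mult_0_right)
qed

lemma equilibrium_sppid_iff_KKT:
  fixes h :: "real ^ 'n \<Rightarrow> real ^ 'p" and g :: "real ^ 'n \<Rightarrow> real ^ 'm"
  assumes "ki_eq > 0" "ki_in > 0" "kp_in > 0" "kd_eq \<ge> 0"
  shows "equilibrium (sppid_field f h g ki_eq kp_eq kd_eq ki_in kp_in) (x, \<nu>, \<xi>) \<longleftrightarrow>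
    KKT f h g x \<nu> \<xi>"
proof -
  have "equilibrium (sppid_field f h g ki_eq kp_eq kd_eq ki_in kp_in) (x, \<nu>, \<xi>) \<longleftrightarrow>
    grad f x + transpose (Jac h x) *v (\<nu> + kp_eq *\<^sub>R h x)
      + transpose (Jac g x) *v relu (\<xi> + kp_in *\<^sub>R g x) = 0 \<and>
    h x = 0 \<and> relu (\<xi> + kp_in *\<^sub>R g x) = \<xi>"
    using assms
    by (simp add: equilibrium_def sppid_field_def zero_prod_def
        matrix_inv_mult_eq_0_iff invertible_M_mat)
  \<comment> \<open>The last two equations simplify the first: \<open>h x = 0\<close> removes the
    \<open>kp_eq\<close> term, and the fixed point equation turns the relu into \<xi>. This is KKT
    stationarity with the dual states as multipliers.\<close>
  also have "\<dots> \<longleftrightarrow> grad f x + transpose (Jac h x) *v \<nu> + transpose (Jac g x) *v \<xi> = 0 \<and>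
    h x = 0 \<and> relu (\<xi> + kp_in *\<^sub>R g x) = \<xi>"
    by auto
  also have "\<dots> \<longleftrightarrow> KKT f h g x \<nu> \<xi>"
    unfolding relu_fixed_point_iff[OF \<open>kp_in > 0\<close>] KKT_def by blast
  finally show ?thesis .
qed

theorem theorem3p1:
  fixes f :: "real ^ 'n \<Rightarrow> real"
    and h :: "real ^ 'n \<Rightarrow> real ^ 'p"
    and g :: "real ^ 'n \<Rightarrow> real ^ 'm"
    and ki_eq kp_eq kd_eq ki_in kp_in :: real
  assumes "C1 f" and "C1 h" and "C1 g"
    and "ki_eq > 0" and "ki_in > 0" and "kp_in > 0"
    and "kp_eq \<ge> 0" and "kd_eq \<ge> 0"
    and "\<exists>x. optimal f h g x \<and> constraint_qualification h g x"
  shows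
    "(\<forall>x \<nu> \<xi>.
        equilibrium (sppid_field f h g ki_eq kp_eq kd_eq ki_in kp_in) (x, \<nu>, \<xi>) \<longleftrightarrow>
        (\<exists>lam \<mu>. 0 \<le> \<mu> \<and> KKT f h g x lam \<mu> \<and> lam = \<nu> \<and> \<mu> = \<xi>))
     \<and>
     (\<forall>x \<nu> \<xi>.
        (\<lambda>x'. L_aug f h g kp_eq kp_in x' \<nu> \<xi>) differentiable (at x) \<and>
        (\<lambda>\<nu>'. L_aug f h g kp_eq kp_in x \<nu>' \<xi>) differentiable (at \<nu>) \<and>
        (\<lambda>\<xi>'. L_aug f h g kp_eq kp_in x \<nu> \<xi>') differentiable (at \<xi>) \<and>
        sppid_field f h g ki_eq kp_eq kd_eq ki_in kp_in (x, \<nu>, \<xi>) =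
          (- (matrix_inv (M_mat kd_eq h x) *v grad (\<lambda>x'. L_aug f h g kp_eq kp_in x' \<nu> \<xi>) x),
           ki_eq *\<^sub>R grad (\<lambda>\<nu>'. L_aug f h g kp_eq kp_in x \<nu>' \<xi>) \<nu>,
           (ki_in * kp_in) *\<^sub>R grad (\<lambda>\<xi>'. L_aug f h g kp_eq kp_in x \<nu> \<xi>') \<xi>))"
proof (intro conjI allI)
  fix x :: "real ^ 'n" and \<nu> :: "real ^ 'p" and \<xi> :: "real ^ 'm"
  show "equilibrium (sppid_field f h g ki_eq kp_eq kd_eq ki_in kp_in) (x, \<nu>, \<xi>) \<longleftrightarrow>
      (\<exists>lam \<mu>. 0 \<le> \<mu> \<and> KKT f h g x lam \<mu> \<and> lam = \<nu> \<and> \<mu> = \<xi>)"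
    \<comment> \<open>The equations for \<open>lam\<close> and \<mu> eliminate the quantifiers, and
      \<open>KKT\<close> supplies \<open>0 \<le> \<mu>\<close>.\<close>
    by (simp add: equilibrium_sppid_iff_KKT[OF assms(4-6,8)]) (auto simp: KKT_def)
  have "kp_in \<noteq> 0" using assms by simp
  note Dx = GDERIV_L_aug_primal[OF assms(1-3)[THEN differentiable_if_C1] this]
    and D\<nu> = GDERIV_L_aug_eq_dual and D\<xi> = GDERIV_L_aug_in_dual[OF this]
  show "(\<lambda>x'. L_aug f h g kp_eq kp_in x' \<nu> \<xi>) differentiable (at x)"
    by (rule differentiable_if_GDERIV[OF Dx])
  show "(\<lambda>\<nu>'. L_aug f h g kp_eq kp_in x \<nu>' \<xi>) differentiable (at \<nu>)"
    by (rule differentiable_if_GDERIV[OF D\<nu>])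
  show "(\<lambda>\<xi>'. L_aug f h g kp_eq kp_in x \<nu> \<xi>') differentiable (at \<xi>)"
    by (rule differentiable_if_GDERIV[OF D\<xi>])
  show "sppid_field f h g ki_eq kp_eq kd_eq ki_in kp_in (x, \<nu>, \<xi>) =
      (- (matrix_inv (M_mat kd_eq h x) *v grad (\<lambda>x'. L_aug f h g kp_eq kp_in x' \<nu> \<xi>) x),
       ki_eq *\<^sub>R grad (\<lambda>\<nu>'. L_aug f h g kp_eq kp_in x \<nu>' \<xi>) \<nu>,
       (ki_in * kp_in) *\<^sub>R grad (\<lambda>\<xi>'. L_aug f h g kp_eq kp_in x \<nu> \<xi>') \<xi>)"
    \<comment> \<open>Needed in the last component, where \<open>ki_in * kp_in\<close> times
      \<open>1 / kp_in\<close> must reduce to \<open>ki_in\<close>.\<close>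
    using \<open>kp_in \<noteq> 0\<close>
    by (simp add: sppid_field_def grad_eqI[OF Dx] grad_eqI[OF D\<nu>] grad_eqI[OF D\<xi>])
qed

end
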